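(* The point spectrum of the right convolution operator $R_{\widetilde\mu}:F\mapsto F*\widetilde\mu$ on $\ell^2(H\wr G)$ comprises (that is, contains) the set $$\Lambda=\bigcup\bigl\{\operatorname{spec}(P_A): A\in\mathcal C,\ A\neq\emptyset\bigr\}\cup\{0\}.$$ For each eigenvalue $\lambda\in\Lambda$, the eigenspace contains infinitely many linearly independent eigenfunctions with finite support.
   Context: $G$ is a finitely generated group with identity $e$; $H$ is a finite group with identity $o$ and $|H|\ge 2$. Let $\mathcal{L}=\bigoplus_G H$ be the group (under pointwise multiplication) of functions $\eta:G\to H$ with finite support $\{x:\eta(x)\ne o\}$; its identity is $\iota\equiv o$. $G$ acts on $\mathcal L$ by $L_g\eta(x)=\eta(g^{-1}x)$. The lamplighter group is $H\wr G=\mathcal{L}\rtimes G$ with $(\eta,g)(\eta',g')=(\eta\cdot L_g\eta',gg')$. $G$ and $H$ embed into $H\wr G$ via $g\mapsto(\iota,g)$ and $h\mapsto(\eta_e^h,e)$, where $\eta_e^h(e)=h$ and $\eta_e^h(x)=o$ for $x\neq e$; measures on $G$ and $H$ are regarded as measures on $H\wr G$ via these embeddings. $\mu$ is a symmetric probability measure on $G$ whose support $S$ is finite and generates $G$; $p(x,y)=\mu(x^{-1}y)$. The Cayley graph $X(G,S)$ has vertex set $G$ and unoriented edges $[x,xs]$, $x\in G$, $s\in S$. $\nu$ is the uniform distribution on $H$, and $\widetilde\mu=\nu*\mu*\nu$ on $H\wr G$. The point spectrum of $R_{\widetilde\mu}$ is its set of eigenvalues, i.e. the set of $\lambda\in\mathbb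 C$ such that $\lambda I-R_{\widetilde\mu}$ is not injective. $\mathcal C$ is the collection of all finite sets $A\subset G$ with $e\in A$ whose induced subgraph in $X(G,S)$ is connected, together with $A=\emptyset$. For nonempty $A\in\mathcal C$, $P_A$ is the matrix over $A$ with entries $p_A(x,y)=p(x,y)$ for $x,y\in A$ (as an operator on functions on $G$, entries are $0$ unless both $x,y\in A$), and $\operatorname{spec}(P_A)$ is its spectrum.
   Formalization: The claim of infinitely many linearly independent eigenfunctions is stated only for infinite G; for finite G the group H≀G is finite and ℓ² is finite-dimensional, so the claim is false. The containment of Λ in the point spectrum is stated for every G. *)

theory Defs
  imports
    "HOL-Probability.Probability"
    "HOL-Algebra.Algebra"
    "HOL-Library.Function_Algebras"
    "Jordan_Normal_Form.Spectral_Radius"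
    "Graph_Theory.Digraph_Component"
begin

text \<open>Lamplighter groups. A configuration is extensional on the carrier of G (value
  \<^term>\<open>undefined\<close> outside), as in the library's restricted direct sum.\<close>

definition lamp_group ::
    "('h, 'n) monoid_scheme \<Rightarrow> ('g, 'm) monoid_scheme \<Rightarrow> ('g \<Rightarrow> 'h) monoid"
  where "lamp_group H G = sum_group (carrier G) (\<lambda>_. H)"

definition lamp_shift :: "('g, 'm) monoid_scheme \<Rightarrow> 'g \<Rightarrow> ('g \<Rightarrow> 'h) \<Rightarrow> ('g \<Rightarrow> 'h)"
  where "lamp_shift G g \<eta> = (\<lambda>x\<in>carrier G. \<eta> (inv\<^bsub>G\<^esub> g \<otimes>\<^bsub>G\<^esub> x))"

definition wreath ::
    "('h, 'n) monoid_scheme \<Rightarrow> ('g, 'm) monoid_scheme \<Rightarrow> (('g \<Rightarrow> 'h) \<times> 'g) monoid"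
  where "wreath H G =
    \<lparr>carrier = carrier (lamp_group H G) \<times> carrier G,
     mult = (\<lambda>(\<eta>, g) (\<eta>', g'). (\<eta> \<otimes>\<^bsub>lamp_group H G\<^esub> lamp_shift G g \<eta>', g \<otimes>\<^bsub>G\<^esub> g')),
     one = (\<one>\<^bsub>lamp_group H G\<^esub>, \<one>\<^bsub>G\<^esub>)\<rparr>"

definition embed_base ::
    "('h, 'n) monoid_scheme \<Rightarrow> ('g, 'm) monoid_scheme \<Rightarrow> 'g \<Rightarrow> ('g \<Rightarrow> 'h) \<times> 'g"
  where "embed_base H G g = (\<one>\<^bsub>lamp_group H G\<^esub>, g)"

definition embed_lamp ::
    "('h, 'n) monoid_scheme \<Rightarrow> ('g, 'm) monoid_scheme \<Rightarrow> 'h \<Rightarrow> ('g \<Rightarrow> 'h) \<times> 'g"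
  where "embed_lamp H G h =
    ((\<lambda>x\<in>carrier G. if x = \<one>\<^bsub>G\<^esub> then h else \<one>\<^bsub>H\<^esub>), \<one>\<^bsub>G\<^esub>)"

lemma group_wreath:
  assumes "Group.group H" and "Group.group G"
  shows "Group.group (wreath H G)"
proof -
  interpret H: Group.group H by fact
  interpret G: Group.group G by fact
  have carr: "carrier (lamp_group H G) =
      {\<eta> \<in> carrier G \<rightarrow>\<^sub>E carrier H. finite {x \<in> carrier G. \<eta> x \<noteq> \<one>\<^bsub>H\<^esub>}}"
    unfolding lamp_group_def by (rule carrier_sum_group) (rule assms(1))
  interpret L: Group.group "lamp_group H G"
    unfolding lamp_group_def by (rule sum_group) (rule assms(1))
  have shift: "lamp_shift G g \<eta> \<in> carrier (lamp_group H G)"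
    if "g \<in> carrier G" "\<eta> \<in> carrier (lamp_group H G)" for g \<eta>
  proof -
    have "{x \<in> carrier G. \<eta> (inv\<^bsub>G\<^esub> g \<otimes>\<^bsub>G\<^esub> x) \<noteq> \<one>\<^bsub>H\<^esub>}
        \<subseteq> (\<lambda>y. g \<otimes>\<^bsub>G\<^esub> y) ` {x \<in> carrier G. \<eta> x \<noteq> \<one>\<^bsub>H\<^esub>}"
    proof
      fix x assume x: "x \<in> {x \<in> carrier G. \<eta> (inv\<^bsub>G\<^esub> g \<otimes>\<^bsub>G\<^esub> x) \<noteq> \<one>\<^bsub>H\<^esub>}"
      have "x = g \<otimes>\<^bsub>G\<^esub> (inv\<^bsub>G\<^esub> g \<otimes>\<^bsub>G\<^esub> x)"
        using x that by (simp add: G.m_assoc[symmetric])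
      with x that show "x \<in> (\<lambda>y. g \<otimes>\<^bsub>G\<^esub> y) ` {x \<in> carrier G. \<eta> x \<noteq> \<one>\<^bsub>H\<^esub>}"
        by blast
    qed
    moreover have "finite {x \<in> carrier G. \<eta> x \<noteq> \<one>\<^bsub>H\<^esub>}" using that carr by simp
    ultimately have "finite {x \<in> carrier G. \<eta> (inv\<^bsub>G\<^esub> g \<otimes>\<^bsub>G\<^esub> x) \<noteq> \<one>\<^bsub>H\<^esub>}"
      by (meson finite_imageI finite_subset)
    then show ?thesis
      using that unfolding carr lamp_shift_def
      by (auto simp: PiE_iff cong: conj_cong)
  qed
  have mult: "\<eta> \<otimes>\<^bsub>lamp_group H G\<^esub> \<eta>' = (\<lambda>x\<in>carrier G. \<eta> x \<otimes>\<^bsub>H\<^esub> \<eta>' x)" for \<eta> \<eta>'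
    by (simp add: lamp_group_def)
  have one: "\<one>\<^bsub>lamp_group H G\<^esub> = (\<lambda>x\<in>carrier G. \<one>\<^bsub>H\<^esub>)"
    by (simp add: lamp_group_def)
  have val: "\<eta> x \<in> carrier H" if "\<eta> \<in> carrier (lamp_group H G)" "x \<in> carrier G" for \<eta> x
    using that carr by (auto simp: PiE_iff)
  have shift_mult: "lamp_shift G g (\<eta> \<otimes>\<^bsub>lamp_group H G\<^esub> \<eta>') =
      lamp_shift G g \<eta> \<otimes>\<^bsub>lamp_group H G\<^esub> lamp_shift G g \<eta>'" if "g \<in> carrier G" for g \<eta> \<eta>'
    using that by (auto simp: lamp_shift_def mult restrict_def fun_eq_iff)
  have shift_shift: "lamp_shift G g (lamp_shift G g' \<eta>) = lamp_shift G (g \<otimes>\<^bsub>G\<^esub> g') \<eta>"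
    if "g \<in> carrier G" "g' \<in> carrier G" for g g' \<eta>
    using that by (auto simp: lamp_shift_def restrict_def fun_eq_iff G.inv_mult_group G.m_assoc)
  have shift_one: "lamp_shift G \<one>\<^bsub>G\<^esub> \<eta> = \<eta>" if "\<eta> \<in> carrier (lamp_group H G)" for \<eta>
    using that carr by (auto simp: lamp_shift_def restrict_def fun_eq_iff PiE_iff extensional_def)
  have shift_id: "lamp_shift G g \<one>\<^bsub>lamp_group H G\<^esub> = \<one>\<^bsub>lamp_group H G\<^esub>"
    if "g \<in> carrier G" for g
    using that by (auto simp: lamp_shift_def one restrict_def fun_eq_iff)
  show ?thesis
  proof (rule groupI)
    fix x assume x: "x \<in> carrier (wreath H G)"
    obtain \<eta> g where eq: "x = (\<eta>, g)" by (cases x)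
    define y where "y = (lamp_shift G (inv\<^bsub>G\<^esub> g) (inv\<^bsub>lamp_group H G\<^esub> \<eta>), inv\<^bsub>G\<^esub> g)"
    have "y \<in> carrier (wreath H G)"
      using x eq by (auto simp: wreath_def y_def intro!: shift)
    moreover have "y \<otimes>\<^bsub>wreath H G\<^esub> x = \<one>\<^bsub>wreath H G\<^esub>"
      using x eq by (auto simp: wreath_def y_def shift_mult[symmetric] shift_id)
    ultimately show "\<exists>y\<in>carrier (wreath H G). y \<otimes>\<^bsub>wreath H G\<^esub> x = \<one>\<^bsub>wreath H G\<^esub>" by blast
  qed (auto simp: wreath_def shift shift_mult shift_shift shift_one L.m_assoc G.m_assoc)
qed


text \<open>Measures on groups.\<close>

definition conv_pmf :: "('k, 'm) monoid_scheme \<Rightarrow> 'k pmf \<Rightarrow> 'k pmf \<Rightarrow> 'k pmf"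
  where "conv_pmf K \<alpha> \<beta> = map_pmf (\<lambda>(x, y). x \<otimes>\<^bsub>K\<^esub> y) (pair_pmf \<alpha> \<beta>)"

definition symmetric_pmf :: "('g, 'm) monoid_scheme \<Rightarrow> 'g pmf \<Rightarrow> bool"
  where "symmetric_pmf G \<mu> \<longleftrightarrow> (\<forall>x\<in>carrier G. pmf \<mu> (inv\<^bsub>G\<^esub> x) = pmf \<mu> x)"

definition mu_tilde ::
    "('h, 'n) monoid_scheme \<Rightarrow> ('g, 'm) monoid_scheme \<Rightarrow> 'g pmf \<Rightarrow> (('g \<Rightarrow> 'h) \<times> 'g) pmf"
  where "mu_tilde H G \<mu> =
    (let \<nu> = map_pmf (embed_lamp H G) (pmf_of_set (carrier H))
     in conv_pmf (wreath H G)
          (conv_pmf (wreath H G) \<nu> (map_pmf (embed_base H G) \<mu>)) \<nu>)"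


text \<open>Functions on a group K are represented by functions on the ambient type that vanish
  outside the carrier of K.\<close>

definition ell2 :: "('k, 'm) monoid_scheme \<Rightarrow> ('k \<Rightarrow> complex) set"
  where "ell2 K = {F. (\<forall>x. x \<notin> carrier K \<longrightarrow> F x = 0) \<and>
    (\<lambda>x. (cmod (F x))\<^sup>2) summable_on carrier K}"

definition right_conv ::
    "('k, 'm) monoid_scheme \<Rightarrow> 'k pmf \<Rightarrow> ('k \<Rightarrow> complex) \<Rightarrow> ('k \<Rightarrow> complex)"
  where "right_conv K \<alpha> F = (\<lambda>x. if x \<in> carrier K
    then \<Sum>\<^sub>\<infinity>y\<in>carrier K. F y * complex_of_real (pmf \<alpha> (inv\<^bsub>K\<^esub> y \<otimes>\<^bsub>K\<^esub> x)) else 0)"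

definition fscale :: "complex \<Rightarrow> ('k \<Rightarrow> complex) \<Rightarrow> ('k \<Rightarrow> complex)"
  where "fscale c F = (\<lambda>x. c * F x)"

interpretation cfun: vector_space fscale
  by unfold_locales (auto simp: fscale_def fun_eq_iff algebra_simps)

definition point_spectrum :: "('k, 'm) monoid_scheme \<Rightarrow> 'k pmf \<Rightarrow> complex set"
  where "point_spectrum K \<alpha> =
    {l. \<not> inj_on (\<lambda>F. fscale l F - right_conv K \<alpha> F) (ell2 K)}"

definition eigenspace ::
    "('k, 'm) monoid_scheme \<Rightarrow> 'k pmf \<Rightarrow> complex \<Rightarrow> ('k \<Rightarrow> complex) set"
  where "eigenspace K \<alpha> l = {F \<in> ell2 K. right_conv K \<alpha> F = fscale l F}"


text \<open>Finite clusters in the Cayley graph. The unoriented edges are encoded as arcs in one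
  direction; \<^const>\<open>Digraph_Component.connected\<close> symmetrizes the arc relation.\<close>

definition cayley_graph :: "('g, 'm) monoid_scheme \<Rightarrow> 'g set \<Rightarrow> ('g, 'g \<times> 'g) pre_digraph"
  where "cayley_graph G S =
    \<lparr>verts = carrier G, arcs = {(x, x \<otimes>\<^bsub>G\<^esub> s) | x s. x \<in> carrier G \<and> s \<in> S},
     tail = fst, head = snd\<rparr>"

definition clusters :: "('g, 'm) monoid_scheme \<Rightarrow> 'g set \<Rightarrow> 'g set set"
  where "clusters G S =
    {A. A \<subseteq> carrier G \<and> finite A \<and> \<one>\<^bsub>G\<^esub> \<in> A \<and>
        Digraph_Component.connected (cayley_graph G S \<restriction> A)} \<union> {{}}"

text \<open>The library's matrices are indexed by natural numbers, so A is enumerated; a different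
  enumeration conjugates the matrix by a permutation matrix and leaves the spectrum unchanged.\<close>

definition enum_list :: "'a set \<Rightarrow> 'a list"
  where "enum_list A = (SOME xs. distinct xs \<and> set xs = A)"

definition P_matrix :: "('g, 'm) monoid_scheme \<Rightarrow> 'g pmf \<Rightarrow> 'g set \<Rightarrow> complex Matrix.mat"
  where "P_matrix G \<mu> A = Matrix.mat (card A) (card A)
    (\<lambda>(i, j). complex_of_real (pmf \<mu> (inv\<^bsub>G\<^esub> (enum_list A ! i) \<otimes>\<^bsub>G\<^esub> (enum_list A ! j))))"

definition Lambda_set :: "('g, 'm) monoid_scheme \<Rightarrow> 'g pmf \<Rightarrow> complex set"
  where "Lambda_set G \<mu> =
    \<Union>{spectrum (P_matrix G \<mu> A) | A. A \<in> clusters G (set_pmf \<mu>) \<and> A \<noteq> {}} \<union> {0}"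

end

theory Submission
  imports Defs
begin

text \<open>Right convolution with \<open>\<nu> * \<mu> * \<nu>\<close> averages over the lamp at the current position, makes a
  base step, and averages over the lamp again. Given a row eigenvector \<open>f\<close> of \<open>P\<^sub>A\<close>, take
  \<open>F(\<eta>, g) = f(g) \<phi>(\<eta>)\<close>, where \<open>\<phi>\<close> ignores the lamps in \<open>A\<close>, has mean zero in each lamp of a finite
  set \<open>B\<close> containing the outer boundary of \<open>A\<close>, and requires all other lamps to be off. A step out of
  \<open>A\<close> lands in \<open>B\<close>, where the second average annihilates it, so \<open>F\<close> is an eigenfunction with the same
  eigenvalue. Enlarging \<open>B\<close> by one further point \<open>b\<close> gives a family in which only the function indexed
  by \<open>b\<close> sees the configuration with its single lit lamp at \<open>b\<close>; hence independence. For the eigenvalue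
  \<open>0\<close>, the choice \<open>A = {}\<close>, \<open>B = {b}\<close>, \<open>f = 1\<^sub>b\<close> already makes the first average vanish.\<close>

section \<open>Right convolution by finitely supported measures on a group\<close>

lemma (in Group.group) mult_inv_cancel:
  "a \<in> carrier G \<Longrightarrow> b \<in> carrier G \<Longrightarrow> a \<otimes> (inv a \<otimes> b) = b"
  by (simp add: m_assoc[symmetric])

text \<open>Substituting \<open>k = inv y \<otimes> x\<close> turns the sum over the group into an
  average over the last step \<open>k\<close>, taken from the previous point
  \<open>x \<otimes> inv k\<close>. Finite support reduces the infinite sum to a finite one, so the
  identity holds for every \<open>F\<close>.\<close>

lemma right_conv_eq_expectation:
  assumes "Group.group K" "set_pmf \<alpha> \<subseteq> carrier K" "finite (set_pmf \<alpha>)" "x \<in> carrier K"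
  shows "right_conv K \<alpha> F x = measure_pmf.expectation \<alpha> (\<lambda>k. F (x \<otimes>\<^bsub>K\<^esub> inv\<^bsub>K\<^esub> k))"
proof -
  interpret K: Group.group K by fact
  let ?g = "\<lambda>k. x \<otimes>\<^bsub>K\<^esub> inv\<^bsub>K\<^esub> k"
  have inj: "inj_on ?g (set_pmf \<alpha>)"
    using assms(2,4) by (intro inj_onI) (metis K.inv_closed K.inv_inv K.l_cancel subset_iff)
  have mem: "y \<in> ?g ` set_pmf \<alpha>"
    if "y \<in> carrier K" "inv\<^bsub>K\<^esub> y \<otimes>\<^bsub>K\<^esub> x \<in> set_pmf \<alpha>" for y
  proof -
    have "y = ?g (inv\<^bsub>K\<^esub> y \<otimes>\<^bsub>K\<^esub> x)"
      using that assms(4) by (simp add: K.inv_mult_group K.m_assoc[symmetric])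
    then show ?thesis using that by blast
  qed
  have recover: "inv\<^bsub>K\<^esub> (?g k) \<otimes>\<^bsub>K\<^esub> x = k" if "k \<in> set_pmf \<alpha>" for k
    using that assms(2,4) by (auto simp: K.inv_mult_group K.m_assoc)
  have "right_conv K \<alpha> F x = (\<Sum>\<^sub>\<infinity>y\<in>?g ` set_pmf \<alpha>. F y * of_real (pmf \<alpha> (inv\<^bsub>K\<^esub> y \<otimes>\<^bsub>K\<^esub> x)))"
    unfolding right_conv_def using assms(2,4)
    by (auto intro!: infsum_cong_neutral simp: set_pmf_iff[symmetric] pmf_eq_0_set_pmf dest: mem)
  also have "\<dots> = (\<Sum>y\<in>?g ` set_pmf \<alpha>. F y * of_real (pmf \<alpha> (inv\<^bsub>K\<^esub> y \<otimes>\<^bsub>K\<^esub> x)))"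
    using assms(3) by simp
  also have "\<dots> = (\<Sum>k\<in>set_pmf \<alpha>. F (?g k) * of_real (pmf \<alpha> k))"
    by (subst sum.reindex[OF inj]) (simp add: recover)
  also have "\<dots> = measure_pmf.expectation \<alpha> (\<lambda>k. F (?g k))"
    by (subst integral_measure_pmf[OF assms(3)]) (auto simp: scaleR_conv_of_real mult.commute)
  finally show ?thesis .
qed

lemma right_conv_outside: "x \<notin> carrier K \<Longrightarrow> right_conv K \<alpha> F x = 0"
  by (simp add: right_conv_def)

lemma set_conv_pmf: "set_pmf (conv_pmf K \<alpha> \<beta>) = (\<lambda>(a, b). a \<otimes>\<^bsub>K\<^esub> b) ` (set_pmf \<alpha> \<times> set_pmf \<beta>)"
  by (simp add: conv_pmf_def)

text \<open>Associativity of convolution. Because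
  \<open>inv (a \<otimes> b) = inv b \<otimes> inv a\<close>, the left factor of the product acts on
  \<open>F\<close> first.\<close>

lemma right_conv_conv_pmf:
  assumes "Group.group K"
    and "set_pmf \<alpha> \<subseteq> carrier K" "finite (set_pmf \<alpha>)"
    and "set_pmf \<beta> \<subseteq> carrier K" "finite (set_pmf \<beta>)"
  shows "right_conv K (conv_pmf K \<alpha> \<beta>) F = right_conv K \<beta> (right_conv K \<alpha> F)"
proof
  fix x
  interpret K: Group.group K by fact
  let ?A = "set_pmf \<alpha>" and ?B = "set_pmf \<beta>"
  show "right_conv K (conv_pmf K \<alpha> \<beta>) F x = right_conv K \<beta> (right_conv K \<alpha> F) x"
  proof (cases "x \<in> carrier K")
    case x: True
    have sub: "set_pmf (conv_pmf K \<alpha> \<beta>) \<subseteq> carrier K" "finite (set_pmf (conv_pmf K \<alpha> \<beta>))"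
      using assms(2-5) by (auto simp: set_conv_pmf)
    have "right_conv K (conv_pmf K \<alpha> \<beta>) F x
        = measure_pmf.expectation (pair_pmf \<alpha> \<beta>) (\<lambda>(a, b). F (x \<otimes>\<^bsub>K\<^esub> inv\<^bsub>K\<^esub> (a \<otimes>\<^bsub>K\<^esub> b)))"
      by (subst right_conv_eq_expectation[OF assms(1) sub x])
        (simp add: conv_pmf_def integral_map_pmf case_prod_unfold)
    also have "\<dots> = (\<Sum>(a, b)\<in>?A \<times> ?B. pmf \<alpha> a *\<^sub>R pmf \<beta> b *\<^sub>R F (x \<otimes>\<^bsub>K\<^esub> inv\<^bsub>K\<^esub> (a \<otimes>\<^bsub>K\<^esub> b)))"
      using assms(3,5)
      by (subst integral_measure_pmf[of "?A \<times> ?B"]) (auto simp: pmf_pair intro!: sum.cong)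
    \<comment> \<open>The sum over \<open>b\<close> moves outside so that the inner sum becomes the
      convolution with \<alpha> at \<open>x \<otimes> inv b\<close>.\<close>
    also have "\<dots> = (\<Sum>b\<in>?B. \<Sum>a\<in>?A. pmf \<alpha> a *\<^sub>R pmf \<beta> b *\<^sub>R F (x \<otimes>\<^bsub>K\<^esub> inv\<^bsub>K\<^esub> (a \<otimes>\<^bsub>K\<^esub> b)))"
      by (subst sum.cartesian_product[symmetric]) (rule sum.swap)
    also have "\<dots> = (\<Sum>b\<in>?B. pmf \<beta> b *\<^sub>R right_conv K \<alpha> F (x \<otimes>\<^bsub>K\<^esub> inv\<^bsub>K\<^esub> b))"
    proof (rule sum.cong)
      fix b assume "b \<in> ?B"
      then have b: "b \<in> carrier K" using assms(4) by auto
      have "right_conv K \<alpha> F (x \<otimes>\<^bsub>K\<^esub> inv\<^bsub>K\<^esub> b)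
          = (\<Sum>a\<in>?A. pmf \<alpha> a *\<^sub>R F (x \<otimes>\<^bsub>K\<^esub> inv\<^bsub>K\<^esub> b \<otimes>\<^bsub>K\<^esub> inv\<^bsub>K\<^esub> a))"
        using x b by (subst right_conv_eq_expectation[OF assms(1-3)])
          (auto intro!: integral_measure_pmf[OF assms(3)])
      also have "\<dots> = (\<Sum>a\<in>?A. pmf \<alpha> a *\<^sub>R F (x \<otimes>\<^bsub>K\<^esub> inv\<^bsub>K\<^esub> (a \<otimes>\<^bsub>K\<^esub> b)))"
        using assms(2) x b by (intro sum.cong) (auto simp: K.inv_mult_group K.m_assoc)
      finally show "(\<Sum>a\<in>?A. pmf \<alpha> a *\<^sub>R pmf \<beta> b *\<^sub>R F (x \<otimes>\<^bsub>K\<^esub> inv\<^bsub>K\<^esub> (a \<otimes>\<^bsub>K\<^esub> b)))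
          = pmf \<beta> b *\<^sub>R right_conv K \<alpha> F (x \<otimes>\<^bsub>K\<^esub> inv\<^bsub>K\<^esub> b)"
        by (simp add: scaleR_sum_right mult.commute)
    qed simp
    also have "\<dots> = right_conv K \<beta> (right_conv K \<alpha> F) x"
      unfolding right_conv_eq_expectation[OF assms(1,4,5) x]
      by (rule integral_measure_pmf[OF assms(5), symmetric]) auto
    finally show ?thesis .
  qed (simp add: right_conv_outside)
qed

section \<open>Square summability, point spectrum and linear independence\<close>

lemma finite_support_in_ell2:
  assumes "\<And>x. x \<notin> carrier K \<Longrightarrow> F x = 0" "finite {x. F x \<noteq> 0}"
  shows "F \<in> ell2 K"
proof -
  have "(\<lambda>x. (cmod (F x))\<^sup>2) summable_on {x. F x \<noteq> 0}"
    using assms(2) by (rule summable_on_finite)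
  then have "(\<lambda>x. (cmod (F x))\<^sup>2) summable_on carrier K"
    by (rule summable_on_cong_neutral[THEN iffD1, rotated -1]) (use assms(1) in auto)
  then show ?thesis using assms(1) by (auto simp: ell2_def)
qed

text \<open>\<open>F\<close> and \<open>0\<close> are distinct elements of \<open>ell2 K\<close>
  with the same image \<open>0\<close> under the operator \<open>l I - R\<close>.\<close>

lemma eigenvector_in_point_spectrum:
  assumes "F \<in> eigenspace K \<alpha> l" "F \<noteq> 0"
  shows "l \<in> point_spectrum K \<alpha>"
proof -
  have "0 \<in> ell2 K" by (simp add: ell2_def)
  moreover have "fscale l 0 - right_conv K \<alpha> 0 = 0"
    by (auto simp: fscale_def right_conv_def fun_eq_iff)
  moreover have "F \<in> ell2 K" "fscale l F - right_conv K \<alpha> F = 0"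
    using assms(1) by (auto simp: eigenspace_def)
  ultimately show ?thesis
    using assms(2) unfolding point_spectrum_def inj_on_def by fastforce
qed

text \<open>Evaluating a vanishing linear combination at the test point \<open>t i\<close> leaves
  only the coefficient of \<open>F i\<close>, times the nonzero number
  \<open>F i (t i)\<close>.\<close>

lemma independent_if_separated:
  fixes F :: "'i \<Rightarrow> 'k \<Rightarrow> complex"
  assumes "\<And>i. i \<in> I \<Longrightarrow> F i (t i) \<noteq> 0"
    and "\<And>i j. i \<in> I \<Longrightarrow> j \<in> I \<Longrightarrow> i \<noteq> j \<Longrightarrow> F j (t i) = 0"
  shows "inj_on F I" "cfun.independent (F ` I)"
proof -
  show inj: "inj_on F I"
    using assms by (intro inj_onI) metis
  show "cfun.independent (F ` I)"
  proof (subst cfun.independent_explicit_module, intro allI impI)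
    fix T u v
    assume T: "finite T" "T \<subseteq> F ` I" and sum: "(\<Sum>w\<in>T. fscale (u w) w) = 0" and v: "v \<in> T"
    obtain i where i: "i \<in> I" "v = F i" using T v by blast
    have "0 = (\<Sum>w\<in>T. fscale (u w) w) (t i)" by (simp add: sum)
    also have "\<dots> = (\<Sum>w\<in>T. u w * w (t i))"
      using T(1) by (induction rule: finite_induct) (simp_all add: fscale_def)
    also have "\<dots> = (\<Sum>w\<in>{v}. u w * w (t i))"
      using T v i assms(2) by (intro sum.mono_neutral_right) auto
    finally show "u v = 0" using i assms(1) by auto
  qed
qed

section \<open>Eigenvectors of the enumerated matrix as functions on a finite set\<close>

lemma enum_list:
  assumes "finite A"
  shows "distinct (enum_list A)" "set (enum_list A) = A"
proof -
  have "\<exists>xs. distinct xs \<and> set xs = A" using finite_distinct_list[OF assms] by blast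
  then have "distinct (enum_list A) \<and> set (enum_list A) = A"
    unfolding enum_list_def by (rule someI_ex)
  then show "distinct (enum_list A)" "set (enum_list A) = A" by auto
qed

text \<open>By symmetry of \<open>\<mu>\<close> a column eigenvector of the matrix is also a row eigenvector, which is
  what right convolution requires.\<close>

lemma P_matrix_eigenfunction:
  fixes G :: "('g, 'm) monoid_scheme"
  assumes "Group.group G" "symmetric_pmf G \<mu>" "finite A" "A \<subseteq> carrier G"
    and "l \<in> spectrum (P_matrix G \<mu> A)"
  shows "\<exists>f :: 'g \<Rightarrow> complex. (\<forall>x. x \<notin> A \<longrightarrow> f x = 0) \<and> (\<exists>x\<in>A. f x \<noteq> 0) \<and>
    (\<forall>y\<in>A. (\<Sum>x\<in>A. f x * of_real (pmf \<mu> (inv\<^bsub>G\<^esub> x \<otimes>\<^bsub>G\<^esub> y))) = l * f y)"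
proof -
  interpret G: Group.group G by fact
  let ?n = "card A" and ?xs = "enum_list A"
  have len: "length ?xs = ?n" using enum_list[OF assms(3)] by (metis distinct_card)
  have bij: "bij_betw (nth ?xs) {..<?n} A"
    using bij_betw_nth[of ?xs "{..<?n}" A] enum_list[OF assms(3)] len by auto
  define idx where "idx = inv_into {..<?n} (nth ?xs)"
  have idx: "idx (?xs ! i) = i" if "i < ?n" for i
    unfolding idx_def using that bij by (simp add: bij_betw_inv_into_left)
  obtain v where v: "v \<in> carrier_vec ?n" "v \<noteq> 0\<^sub>v ?n" "P_matrix G \<mu> A *\<^sub>v v = l \<cdot>\<^sub>v v"
    using assms(5) by (auto simp: spectrum_def eigenvalue_def eigenvector_def P_matrix_def)
  have row: "(\<Sum>j<?n. of_real (pmf \<mu> (inv\<^bsub>G\<^esub> (?xs ! i) \<otimes>\<^bsub>G\<^esub> (?xs ! j))) * vec_index v j)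
      = l * vec_index v i" if "i < ?n" for i
  proof -
    have "vec_index (P_matrix G \<mu> A *\<^sub>v v) i
        = (\<Sum>j<?n. of_real (pmf \<mu> (inv\<^bsub>G\<^esub> (?xs ! i) \<otimes>\<^bsub>G\<^esub> (?xs ! j))) * vec_index v j)"
      using that v(1) by (simp add: P_matrix_def scalar_prod_def atLeast0LessThan)
    then show ?thesis using that v by simp
  qed
  \<comment> \<open>The column eigenvector is carried back along the enumeration and extended by 0
    off \<open>A\<close>.\<close>
  define f where "f x = (if x \<in> A then vec_index v (idx x) else 0)" for x
  have f_nth: "f (?xs ! i) = vec_index v i" if "i < ?n" for i
    using that idx bij by (auto simp: f_def bij_betw_def)
  have nz: "\<exists>x\<in>A. f x \<noteq> 0"
  proof -
    obtain i where "i < ?n" "vec_index v i \<noteq> 0"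
      using v(1,2) by (metis carrier_vecD eq_vecI index_zero_vec)
    then show ?thesis using f_nth bij by (metis bij_betwE lessThan_iff)
  qed
  have eig: "(\<Sum>x\<in>A. f x * of_real (pmf \<mu> (inv\<^bsub>G\<^esub> x \<otimes>\<^bsub>G\<^esub> y))) = l * f y" if y: "y \<in> A" for y
  proof -
    obtain i where i: "i < ?n" "y = ?xs ! i" using y bij by (auto simp: bij_betw_def)
    have sym: "pmf \<mu> (inv\<^bsub>G\<^esub> x \<otimes>\<^bsub>G\<^esub> y) = pmf \<mu> (inv\<^bsub>G\<^esub> y \<otimes>\<^bsub>G\<^esub> x)" if "x \<in> A" for x
    proof -
      have "x \<in> carrier G" "y \<in> carrier G" using that y assms(4) by auto
      then have "inv\<^bsub>G\<^esub> x \<otimes>\<^bsub>G\<^esub> y = inv\<^bsub>G\<^esub> (inv\<^bsub>G\<^esub> y \<otimes>\<^bsub>G\<^esub> x)" "inv\<^bsub>G\<^esub> y \<otimes>\<^bsub>G\<^esub> x \<in> carrier G"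
        by (simp_all add: G.inv_mult_group)
      then show ?thesis using assms(2) by (simp add: symmetric_pmf_def)
    qed
    have "(\<Sum>x\<in>A. f x * of_real (pmf \<mu> (inv\<^bsub>G\<^esub> x \<otimes>\<^bsub>G\<^esub> y)))
        = (\<Sum>x\<in>A. of_real (pmf \<mu> (inv\<^bsub>G\<^esub> y \<otimes>\<^bsub>G\<^esub> x)) * f x)"
      by (rule sum.cong) (auto simp: sym)
    also have "\<dots> = (\<Sum>j<?n. of_real (pmf \<mu> (inv\<^bsub>G\<^esub> y \<otimes>\<^bsub>G\<^esub> (?xs ! j))) * f (?xs ! j))"
      by (rule sum.reindex_bij_betw[OF bij, symmetric])
    also have "\<dots> = l * f y"
      using row[OF i(1)] by (simp add: f_nth i)
    finally show ?thesis .
  qed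
  show ?thesis by (intro exI[of _ f] conjI allI impI ballI nz eig) (simp_all add: f_def)
qed

section \<open>Multiplication and inverses in the wreath product\<close>

text \<open>The element \<open>h0\<close> is a second lamp state; the mean-zero lamp function and
  the test configurations are built from it.\<close>

locale lamplighter = G: Group.group G + H: Group.group H
  for G :: "('g, 'm) monoid_scheme" and H :: "('h, 'n) monoid_scheme" +
  fixes h0 :: 'h
  assumes finite_H: "finite (carrier H)"
    and h0: "h0 \<in> carrier H" "h0 \<noteq> \<one>\<^bsub>H\<^esub>"
begin

abbreviation "W \<equiv> wreath H G"
abbreviation "L \<equiv> carrier (lamp_group H G)"

lemma carrier_lamp: "L = {\<eta> \<in> carrier G \<rightarrow>\<^sub>E carrier H. finite {x \<in> carrier G. \<eta> x \<noteq> \<one>\<^bsub>H\<^esub>}}"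
  unfolding lamp_group_def by (rule carrier_sum_group) (rule H.is_group)

lemma carrier_W: "carrier W = L \<times> carrier G"
  by (simp add: wreath_def)

lemma group_W: "Group.group W"
  using group_wreath[OF H.is_group G.is_group] .

lemma lamp_value: "\<eta> \<in> L \<Longrightarrow> x \<in> carrier G \<Longrightarrow> \<eta> x \<in> carrier H"
  by (auto simp: carrier_lamp PiE_iff)

lemma lamp_update:
  assumes "\<eta> \<in> L" "g \<in> carrier G" "h \<in> carrier H"
  shows "\<eta>(g := h) \<in> L"
proof -
  have "finite {x \<in> carrier G. (\<eta>(g := h)) x \<noteq> \<one>\<^bsub>H\<^esub>}"
    using assms(1) by (rule_tac finite_subset[of _ "insert g {x \<in> carrier G. \<eta> x \<noteq> \<one>\<^bsub>H\<^esub>}"])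
      (auto simp: carrier_lamp)
  then show ?thesis
    using assms by (auto simp: carrier_lamp PiE_iff extensional_def)
qed

lemma one_lamp_eq: "\<one>\<^bsub>lamp_group H G\<^esub> = (\<lambda>x\<in>carrier G. \<one>\<^bsub>H\<^esub>)"
  by (simp add: lamp_group_def)

lemma embed_base_carrier: "s \<in> carrier G \<Longrightarrow> embed_base H G s \<in> carrier W"
  by (auto simp: embed_base_def carrier_W one_lamp_eq carrier_lamp)

lemma embed_lamp_carrier:
  assumes "h \<in> carrier H"
  shows "embed_lamp H G h \<in> carrier W"
proof -
  have "finite {x \<in> carrier G. (\<lambda>x\<in>carrier G. if x = \<one>\<^bsub>G\<^esub> then h else \<one>\<^bsub>H\<^esub>) x \<noteq> \<one>\<^bsub>H\<^esub>}"
    by (rule finite_subset[of _ "{\<one>\<^bsub>G\<^esub>}"]) auto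
  then show ?thesis using assms by (auto simp: embed_lamp_def carrier_W carrier_lamp)
qed

lemma mult_embed_base:
  assumes "\<eta> \<in> L" "g \<in> carrier G" "s \<in> carrier G"
  shows "(\<eta>, g) \<otimes>\<^bsub>W\<^esub> embed_base H G s = (\<eta>, g \<otimes>\<^bsub>G\<^esub> s)"
  using assms
  by (auto simp: wreath_def embed_base_def lamp_group_def lamp_shift_def fun_eq_iff PiE_iff
      extensional_def carrier_lamp[unfolded lamp_group_def])

text \<open>The shift by \<open>g\<close> carries the lamp at the identity to \<open>g\<close>, so
  only the lamp at the current position is altered.\<close>

lemma mult_embed_lamp:
  assumes "\<eta> \<in> L" "g \<in> carrier G" "h \<in> carrier H"
  shows "(\<eta>, g) \<otimes>\<^bsub>W\<^esub> embed_lamp H G h = (\<eta>(g := \<eta> g \<otimes>\<^bsub>H\<^esub> h), g)"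
proof -
  have "inv\<^bsub>G\<^esub> g \<otimes>\<^bsub>G\<^esub> x = \<one>\<^bsub>G\<^esub> \<longleftrightarrow> x = g" if "x \<in> carrier G" for x
    using that assms(2) by (metis G.inv_closed G.inv_equality G.inv_inv G.l_inv)
  then show ?thesis using assms lamp_value[OF assms(1)]
    by (auto simp: wreath_def embed_lamp_def lamp_group_def lamp_shift_def fun_eq_iff PiE_iff
      extensional_def carrier_lamp[unfolded lamp_group_def])
qed

text \<open>The identity is written as an embedded element, here of \<open>G\<close> and in
  \<open>one_W_lamp\<close> of \<open>H\<close>, so that the product formulas yield the inverses of
  embedded elements.\<close>

lemma one_W: "\<one>\<^bsub>W\<^esub> = embed_base H G \<one>\<^bsub>G\<^esub>"
  by (simp add: wreath_def embed_base_def)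

lemma one_W_lamp: "\<one>\<^bsub>W\<^esub> = embed_lamp H G \<one>\<^bsub>H\<^esub>"
  by (auto simp: wreath_def embed_lamp_def lamp_group_def fun_eq_iff)

lemma one_lamp: "\<one>\<^bsub>lamp_group H G\<^esub> \<in> L"
  using embed_base_carrier[of "\<one>\<^bsub>G\<^esub>"] by (simp add: embed_base_def carrier_W)

lemma inv_embed_base:
  assumes "s \<in> carrier G"
  shows "inv\<^bsub>W\<^esub> (embed_base H G s) = embed_base H G (inv\<^bsub>G\<^esub> s)"
proof -
  have "embed_base H G (inv\<^bsub>G\<^esub> s) \<otimes>\<^bsub>W\<^esub> embed_base H G s = \<one>\<^bsub>W\<^esub>"
    unfolding one_W using assms mult_embed_base[OF one_lamp, of "inv\<^bsub>G\<^esub> s" s]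
    by (simp add: embed_base_def)
  then show ?thesis
    using assms by (intro group.inv_equality[OF group_W]) (auto intro: embed_base_carrier)
qed

lemma inv_embed_lamp:
  assumes "h \<in> carrier H"
  shows "inv\<^bsub>W\<^esub> (embed_lamp H G h) = embed_lamp H G (inv\<^bsub>H\<^esub> h)"
proof -
  have "fst (embed_lamp H G (inv\<^bsub>H\<^esub> h)) \<in> L"
    using embed_lamp_carrier[of "inv\<^bsub>H\<^esub> h"] assms by (auto simp: carrier_W mem_Times_iff)
  then have "embed_lamp H G (inv\<^bsub>H\<^esub> h) \<otimes>\<^bsub>W\<^esub> embed_lamp H G h = \<one>\<^bsub>W\<^esub>"
    unfolding one_W_lamp
    using assms mult_embed_lamp[of "fst (embed_lamp H G (inv\<^bsub>H\<^esub> h))" "\<one>\<^bsub>G\<^esub>" h]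
    by (auto simp: embed_lamp_def fun_eq_iff)
  then show ?thesis
    using assms by (intro group.inv_equality[OF group_W]) (auto intro: embed_lamp_carrier)
qed

section \<open>Averaging over the lamp at the current position\<close>

definition lamp_law :: "(('g \<Rightarrow> 'h) \<times> 'g) pmf"
  where "lamp_law = map_pmf (embed_lamp H G) (pmf_of_set (carrier H))"

lemma H_ne: "carrier H \<noteq> {}"
  using h0 by blast

lemma set_lamp_law: "set_pmf lamp_law \<subseteq> carrier W" "finite (set_pmf lamp_law)"
  using finite_H H_ne embed_lamp_carrier by (auto simp: lamp_law_def)

text \<open>As \<open>h\<close> runs over the finite group, so does
  \<open>\<eta> g \<otimes> inv h\<close>; under the uniform law the old state of the lamp at
  \<open>g\<close> is forgotten.\<close>

lemma right_conv_lamp_law: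
  assumes "\<eta> \<in> L" "g \<in> carrier G"
  shows "right_conv W lamp_law F (\<eta>, g)
    = (\<Sum>h\<in>carrier H. F (\<eta>(g := h), g)) / of_nat (card (carrier H))"
proof -
  have \<eta>g: "\<eta> g \<in> carrier H" using assms by (rule lamp_value)
  have "right_conv W lamp_law F (\<eta>, g)
      = measure_pmf.expectation lamp_law (\<lambda>k. F ((\<eta>, g) \<otimes>\<^bsub>W\<^esub> inv\<^bsub>W\<^esub> k))"
    using assms by (intro right_conv_eq_expectation[OF group_W set_lamp_law]) (simp add: carrier_W)
  also have "\<dots> = (\<Sum>h\<in>carrier H. F ((\<eta>, g) \<otimes>\<^bsub>W\<^esub> inv\<^bsub>W\<^esub> embed_lamp H G h)) / of_nat (card (carrier H))"
    unfolding lamp_law_def integral_map_pmf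
    using finite_H H_ne
    by (subst integral_measure_pmf[of "carrier H"])
      (auto simp: pmf_of_set scaleR_conv_of_real sum_divide_distrib)
  also have "(\<Sum>h\<in>carrier H. F ((\<eta>, g) \<otimes>\<^bsub>W\<^esub> inv\<^bsub>W\<^esub> embed_lamp H G h))
      = (\<Sum>h\<in>carrier H. F (\<eta>(g := \<eta> g \<otimes>\<^bsub>H\<^esub> inv\<^bsub>H\<^esub> h), g))"
    using assms by (intro sum.cong) (auto simp: inv_embed_lamp mult_embed_lamp)
  also have "\<dots> = (\<Sum>h\<in>carrier H. F (\<eta>(g := h), g))"
    by (rule sum.reindex_bij_witness[where j = "\<lambda>h. \<eta> g \<otimes>\<^bsub>H\<^esub> inv\<^bsub>H\<^esub> h" and i = "\<lambda>h. inv\<^bsub>H\<^esub> h \<otimes>\<^bsub>H\<^esub> \<eta> g"])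
      (use \<eta>g in \<open>auto simp: H.inv_mult_group H.m_assoc H.mult_inv_cancel\<close>)
  finally show ?thesis .
qed

section \<open>The lamp factor, the position factor and the action of each random move on their
  product\<close>

text \<open>The indicator of the identity minus that of \<open>h0\<close>: it has mean zero on
  \<open>H\<close>, yet is nonzero at both states used in the test configurations.\<close>

definition lamp_sign :: "'h \<Rightarrow> complex"
  where "lamp_sign h = (if h = \<one>\<^bsub>H\<^esub> then 1 else if h = h0 then -1 else 0)"

text \<open>This is \<phi>. For finite \<open>A\<close> and \<open>B\<close> the off condition on
  the remaining lamps is what keeps its support finite.\<close>

definition config :: "'g set \<Rightarrow> 'g set \<Rightarrow> ('g \<Rightarrow> 'h) \<Rightarrow> complex"
  where "config A B \<eta> = (if \<forall>x\<in>carrier G - (A \<union> B). \<eta> x = \<one>\<^bsub>H\<^esub> then \<Prod>x\<in>B. lamp_sign (\<eta> x) else 0)"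

text \<open>The cutoff follows the convention that functions on a group vanish outside its
  carrier.\<close>

definition tensor :: "('g \<Rightarrow> complex) \<Rightarrow> (('g \<Rightarrow> 'h) \<Rightarrow> complex) \<Rightarrow> ('g \<Rightarrow> 'h) \<times> 'g \<Rightarrow> complex"
  where "tensor f \<phi> = (\<lambda>(\<eta>, g). if \<eta> \<in> L \<and> g \<in> carrier G then f g * \<phi> \<eta> else 0)"

lemma sum_lamp_sign: "(\<Sum>h\<in>carrier H. lamp_sign h) = 0"
proof -
  have "(\<Sum>h\<in>carrier H. lamp_sign h) = (\<Sum>h\<in>{\<one>\<^bsub>H\<^esub>, h0}. lamp_sign h)"
    using finite_H h0 by (intro sum.mono_neutral_right) (auto simp: lamp_sign_def)
  then show ?thesis using h0 by (simp add: lamp_sign_def)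
qed

lemma config_update_inside:
  assumes "A \<inter> B = {}" "a \<in> A"
  shows "config A B (\<eta>(a := h)) = config A B \<eta>"
proof -
  have "(\<Prod>x\<in>B. lamp_sign ((\<eta>(a := h)) x)) = (\<Prod>x\<in>B. lamp_sign (\<eta> x))"
    using assms by (intro prod.cong) auto
  then show ?thesis using assms(2) by (auto simp: config_def)
qed

lemma sum_config_update_boundary:
  assumes "finite B" "b \<in> B"
  shows "(\<Sum>h\<in>carrier H. config A B (\<eta>(b := h))) = 0"
proof -
  \<comment> \<open>Since \<open>b\<close> lies in \<open>B\<close>, the off condition does not
    concern it, and its lamp enters only through the factor \<open>lamp_sign h\<close>, whose sum
    over \<open>H\<close> is zero.\<close>
  have "config A B (\<eta>(b := h)) = lamp_sign h *
      (if \<forall>x\<in>carrier G - (A \<union> B). \<eta> x = \<one>\<^bsub>H\<^esub> then \<Prod>x\<in>B - {b}. lamp_sign (\<eta> x) else 0)" for h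
  proof -
    have "(\<Prod>x\<in>B. lamp_sign ((\<eta>(b := h)) x))
        = lamp_sign h * (\<Prod>x\<in>B - {b}. lamp_sign ((\<eta>(b := h)) x))"
      using assms by (subst prod.remove[of B b]) auto
    also have "(\<Prod>x\<in>B - {b}. lamp_sign ((\<eta>(b := h)) x)) = (\<Prod>x\<in>B - {b}. lamp_sign (\<eta> x))"
      by (intro prod.cong) auto
    finally show ?thesis using assms(2) by (auto simp: config_def)
  qed
  then show ?thesis by (simp add: sum_distrib_right[symmetric] sum_lamp_sign)
qed

text \<open>At a position in \<open>A\<close> averaging changes nothing, at one in \<open>B\<close>
  it gives zero, and elsewhere \<open>f\<close> already vanishes. The condition on \<open>f\<close>
  speaks of the carrier only, where the row sums to which it is later applied are
  controlled.\<close>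

lemma lamp_average_tensor:
  assumes "A \<inter> B = {}" "finite B"
    and "\<And>x. x \<in> carrier G \<Longrightarrow> x \<notin> A \<union> B \<Longrightarrow> f x = 0"
  shows "right_conv W lamp_law (tensor f (config A B))
    = tensor (\<lambda>x. if x \<in> A then f x else 0) (config A B)"
proof
  fix z :: "('g \<Rightarrow> 'h) \<times> 'g"
  obtain \<eta> g where z: "z = (\<eta>, g)" by (cases z)
  show "right_conv W lamp_law (tensor f (config A B)) z
      = tensor (\<lambda>x. if x \<in> A then f x else 0) (config A B) z"
  proof (cases "\<eta> \<in> L \<and> g \<in> carrier G")
    case True
    then have "right_conv W lamp_law (tensor f (config A B)) z
        = f g * (\<Sum>h\<in>carrier H. config A B (\<eta>(g := h))) / of_nat (card (carrier H))"
      by (simp add: z right_conv_lamp_law tensor_def lamp_update sum_distrib_left)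
    then show ?thesis
      using True assms finite_H H_ne
      by (cases "g \<in> A"; cases "g \<in> B")
        (auto simp: z tensor_def config_update_inside sum_config_update_boundary)
  next
    case False
    then show ?thesis by (auto simp: z right_conv_outside carrier_W tensor_def)
  qed
qed

text \<open>A base step leaves the lamps alone, so only \<open>f\<close> changes: it is multiplied
  as a row vector by the transition matrix. The new position \<open>y\<close> may lie outside
  \<open>A\<close>.\<close>

lemma base_step_tensor:
  assumes "set_pmf \<mu> \<subseteq> carrier G" "finite (set_pmf \<mu>)"
    and "finite A" "A \<subseteq> carrier G" "\<And>x. x \<notin> A \<Longrightarrow> f x = 0"
  shows "right_conv W (map_pmf (embed_base H G) \<mu>) (tensor f \<phi>)
    = tensor (\<lambda>y. \<Sum>x\<in>A. f x * of_real (pmf \<mu> (inv\<^bsub>G\<^esub> x \<otimes>\<^bsub>G\<^esub> y))) \<phi>"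
proof
  fix z :: "('g \<Rightarrow> 'h) \<times> 'g"
  let ?e = "map_pmf (embed_base H G) \<mu>"
  have e: "set_pmf ?e \<subseteq> carrier W" "finite (set_pmf ?e)"
    using assms(1,2) embed_base_carrier by auto
  obtain \<eta> g where z: "z = (\<eta>, g)" by (cases z)
  show "right_conv W ?e (tensor f \<phi>) z
    = tensor (\<lambda>y. \<Sum>x\<in>A. f x * of_real (pmf \<mu> (inv\<^bsub>G\<^esub> x \<otimes>\<^bsub>G\<^esub> y))) \<phi> z"
  proof (cases "\<eta> \<in> L \<and> g \<in> carrier G")
    case True
    have "right_conv W ?e (tensor f \<phi>) z
        = measure_pmf.expectation \<mu> (\<lambda>s. tensor f \<phi> ((\<eta>, g) \<otimes>\<^bsub>W\<^esub> inv\<^bsub>W\<^esub> embed_base H G s))"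
      using True unfolding z
      by (subst right_conv_eq_expectation[OF group_W e]) (auto simp: carrier_W)
    also have "\<dots> = (\<Sum>s\<in>set_pmf \<mu>. of_real (pmf \<mu> s) * (f (g \<otimes>\<^bsub>G\<^esub> inv\<^bsub>G\<^esub> s) * \<phi> \<eta>))"
      using True assms(1)
      by (subst integral_measure_pmf[OF assms(2)])
        (auto intro!: sum.cong simp: scaleR_conv_of_real inv_embed_base mult_embed_base tensor_def
          subset_iff)
    also have "\<dots> = (\<Sum>x\<in>A. f x * of_real (pmf \<mu> (inv\<^bsub>G\<^esub> x \<otimes>\<^bsub>G\<^esub> g)) * \<phi> \<eta>)"
      \<comment> \<open>The step \<open>s\<close> corresponds to the previous position
        \<open>g \<otimes> inv s\<close>. Terms in the exceptional sets vanish: in \<open>S'\<close>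
        because \<open>f\<close> is zero off \<open>A\<close>, in \<open>T'\<close> because \<mu>
        gives the step no mass.\<close>
      by (rule sum.reindex_bij_witness_not_neutral
          [where j = "\<lambda>s. g \<otimes>\<^bsub>G\<^esub> inv\<^bsub>G\<^esub> s" and i = "\<lambda>x. inv\<^bsub>G\<^esub> x \<otimes>\<^bsub>G\<^esub> g"
            and S' = "{s \<in> set_pmf \<mu>. g \<otimes>\<^bsub>G\<^esub> inv\<^bsub>G\<^esub> s \<notin> A}"
            and T' = "{x \<in> A. inv\<^bsub>G\<^esub> x \<otimes>\<^bsub>G\<^esub> g \<notin> set_pmf \<mu>}"])
        (use True assms(1,4) finite_subset[OF _ assms(2)] finite_subset[OF _ assms(3)] assms(5) in
          \<open>auto simp: subset_iff G.inv_mult_group G.m_assoc G.mult_inv_cancel pmf_eq_0_set_pmf\<close>)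
    finally show ?thesis
      using True by (simp add: z tensor_def sum_distrib_right)
  next
    case False
    then show ?thesis by (auto simp: z right_conv_outside carrier_W tensor_def)
  qed
qed

lemma right_conv_mu_tilde:
  assumes "set_pmf \<mu> \<subseteq> carrier G" "finite (set_pmf \<mu>)"
  shows "right_conv W (mu_tilde H G \<mu>) F
    = right_conv W lamp_law (right_conv W (map_pmf (embed_base H G) \<mu>) (right_conv W lamp_law F))"
proof -
  let ?e = "map_pmf (embed_base H G) \<mu>"
  interpret W: Group.group W by (rule group_W)
  have e: "set_pmf ?e \<subseteq> carrier W" "finite (set_pmf ?e)"
    using assms embed_base_carrier by auto
  have "set_pmf (conv_pmf W lamp_law ?e) \<subseteq> carrier W" "finite (set_pmf (conv_pmf W lamp_law ?e))"
    unfolding set_conv_pmf using e set_lamp_law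
    by (auto simp del: set_map_pmf simp: subset_iff intro!: W.m_closed)
  then show ?thesis
    using e set_lamp_law
    by (simp add: mu_tilde_def lamp_law_def[symmetric] right_conv_conv_pmf[OF group_W] Let_def
        del: set_map_pmf)
qed

section \<open>Eigenfunctions with finite support\<close>

text \<open>A configuration in the support is off outside \<open>A \<union> B\<close>, hence
  determined by its pattern there; a finite \<open>H\<close> allows finitely many patterns.\<close>

lemma finite_support_tensor_config:
  assumes "finite A" "finite B" "A \<union> B \<subseteq> carrier G" "\<And>x. x \<notin> A \<union> B \<Longrightarrow> f x = 0"
  shows "finite {z. tensor f (config A B) z \<noteq> 0}"
proof -
  let ?C = "A \<union> B"
  \<comment> \<open>A pattern on \<open>A \<union> B\<close> is completed by off lamps; the outer
    restriction gives the value \<open>undefined\<close> outside the carrier, as configurations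
    require.\<close>
  let ?ext = "\<lambda>\<xi>. \<lambda>x\<in>carrier G. if x \<in> ?C then \<xi> x else \<one>\<^bsub>H\<^esub>"
  have extension: "\<eta> \<in> ?ext ` (?C \<rightarrow>\<^sub>E carrier H)" if "\<eta> \<in> L" "config A B \<eta> \<noteq> 0" for \<eta>
  proof
    have "\<eta> \<in> extensional (carrier G)" using that(1) by (simp add: carrier_lamp PiE_def)
    moreover have "\<forall>x\<in>carrier G - ?C. \<eta> x = \<one>\<^bsub>H\<^esub>"
      using that(2) unfolding config_def by meson
    ultimately have "\<eta> x = (if x \<in> carrier G then if x \<in> ?C then \<eta> x else \<one>\<^bsub>H\<^esub> else undefined)"
      for x
      using extensional_arb[of \<eta> "carrier G" x] by (cases "x \<in> ?C") (auto simp del: Un_iff)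
    then have "\<eta> x = ?ext (restrict \<eta> ?C) x" for x
      unfolding restrict_def by presburger
    then show "\<eta> = ?ext (restrict \<eta> ?C)" by (rule ext)
    show "restrict \<eta> ?C \<in> ?C \<rightarrow>\<^sub>E carrier H"
      using lamp_value[OF that(1)] assms(3) by auto
  qed
  have "{z. tensor f (config A B) z \<noteq> 0} \<subseteq> ?ext ` (?C \<rightarrow>\<^sub>E carrier H) \<times> ?C"
  proof (rule subrelI)
    fix \<eta> g assume "(\<eta>, g) \<in> {z. tensor f (config A B) z \<noteq> 0}"
    then have "\<eta> \<in> L" "config A B \<eta> \<noteq> 0" "f g \<noteq> 0"
      by (auto simp: tensor_def split: if_splits)
    then show "(\<eta>, g) \<in> ?ext ` (?C \<rightarrow>\<^sub>E carrier H) \<times> ?C"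
      using extension[of \<eta>] assms(4)[of g] by blast
  qed
  moreover have "finite (?ext ` (?C \<rightarrow>\<^sub>E carrier H) \<times> ?C)"
    using assms(1,2) finite_H by (intro finite_cartesian_product finite_imageI finite_PiE) auto
  ultimately show ?thesis by (rule finite_subset)
qed

lemma tensor_config_in_ell2:
  assumes "finite A" "finite B" "A \<union> B \<subseteq> carrier G" "\<And>x. x \<notin> A \<union> B \<Longrightarrow> f x = 0"
  shows "tensor f (config A B) \<in> ell2 W"
  by (rule finite_support_in_ell2[OF _ finite_support_tensor_config[OF assms]])
    (auto simp: tensor_def carrier_W split: if_splits)

text \<open>The first average fixes the function because \<open>f\<close> lives on \<open>A\<close>,
  the base step leaks only into \<open>B\<close>, and the second average removes the leak; on
  \<open>A\<close> the eigenvalue equation remains.\<close>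

lemma tensor_config_eigenfunction:
  assumes "set_pmf \<mu> \<subseteq> carrier G" "finite (set_pmf \<mu>)"
    and "finite A" "finite B" "A \<union> B \<subseteq> carrier G" "A \<inter> B = {}"
    and boundary: "\<And>x s. x \<in> A \<Longrightarrow> s \<in> set_pmf \<mu> \<Longrightarrow> x \<otimes>\<^bsub>G\<^esub> s \<in> A \<union> B"
    and f: "\<And>x. x \<notin> A \<Longrightarrow> f x = 0"
    and eig: "\<And>y. y \<in> A \<Longrightarrow> (\<Sum>x\<in>A. f x * of_real (pmf \<mu> (inv\<^bsub>G\<^esub> x \<otimes>\<^bsub>G\<^esub> y))) = l * f y"
  shows "tensor f (config A B) \<in> eigenspace W (mu_tilde H G \<mu>) l"
proof -
  let ?Pf = "\<lambda>y. \<Sum>x\<in>A. f x * of_real (pmf \<mu> (inv\<^bsub>G\<^esub> x \<otimes>\<^bsub>G\<^esub> y))"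
  \<comment> \<open>A nonzero term would give a step of \<mu> from \<open>A\<close> to
    \<open>y\<close>, contrary to \<open>boundary\<close>.\<close>
  have outside: "?Pf y = 0" if y: "y \<in> carrier G" "y \<notin> A \<union> B" for y
  proof (rule sum.neutral, rule ballI)
    fix x assume x: "x \<in> A"
    then have "x \<otimes>\<^bsub>G\<^esub> (inv\<^bsub>G\<^esub> x \<otimes>\<^bsub>G\<^esub> y) = y"
      using y assms(5) by (auto simp: G.m_assoc[symmetric])
    then have "inv\<^bsub>G\<^esub> x \<otimes>\<^bsub>G\<^esub> y \<notin> set_pmf \<mu>"
      using boundary[OF x] y by metis
    then show "f x * of_real (pmf \<mu> (inv\<^bsub>G\<^esub> x \<otimes>\<^bsub>G\<^esub> y)) = 0" by (simp add: set_pmf_iff)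
  qed
  have "(\<lambda>x. if x \<in> A then f x else 0) = f" using f by auto
  then have avg: "right_conv W lamp_law (tensor f (config A B)) = tensor f (config A B)"
    using lamp_average_tensor[OF assms(6,4), of f] f by simp
  have step: "right_conv W (map_pmf (embed_base H G) \<mu>) (tensor f (config A B))
      = tensor ?Pf (config A B)"
    using assms(5) by (intro base_step_tensor[OF assms(1,2,3)] f) auto
  have "right_conv W (mu_tilde H G \<mu>) (tensor f (config A B))
      = tensor (\<lambda>x. if x \<in> A then ?Pf x else 0) (config A B)"
    unfolding right_conv_mu_tilde[OF assms(1,2)] avg step
    by (rule lamp_average_tensor[OF assms(6,4) outside])
  also have "(\<lambda>x. if x \<in> A then ?Pf x else 0) = (\<lambda>x. l * f x)"
    using eig f by auto
  also have "tensor (\<lambda>x. l * f x) (config A B) = fscale l (tensor f (config A B))"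
    by (auto simp: tensor_def fscale_def)
  finally show ?thesis
    using tensor_config_in_ell2[OF assms(3,4,5), of f] f by (simp add: eigenspace_def)
qed

text \<open>With \<open>A\<close> empty, every position carrying \<open>f\<close> lies in
  \<open>B\<close>, so already the first average gives zero.\<close>

lemma tensor_config_kernel:
  assumes "set_pmf \<mu> \<subseteq> carrier G" "finite (set_pmf \<mu>)"
    and "finite B" "B \<subseteq> carrier G" "\<And>x. x \<notin> B \<Longrightarrow> f x = 0"
  shows "tensor f (config {} B) \<in> eigenspace W (mu_tilde H G \<mu>) 0"
proof -
  have zero: "right_conv W \<alpha> (\<lambda>_. 0) = (\<lambda>_. 0)" for \<alpha>
    by (auto simp: right_conv_def)
  have "right_conv W lamp_law (tensor f (config {} B)) = (\<lambda>_. 0)"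
    using lamp_average_tensor[of "{}" B f] assms(3,5) by (auto simp: tensor_def)
  then show ?thesis
    using tensor_config_in_ell2[of "{}" B f] assms
    by (simp add: eigenspace_def fscale_def right_conv_mu_tilde zero)
qed

section \<open>Test configurations and separated families\<close>

definition single_lamp :: "'g \<Rightarrow> ('g \<Rightarrow> 'h)"
  where "single_lamp b = (\<lambda>x\<in>carrier G. if x = b then h0 else \<one>\<^bsub>H\<^esub>)"

lemma single_lamp_carrier: "single_lamp b \<in> L"
proof -
  have "finite {x \<in> carrier G. single_lamp b x \<noteq> \<one>\<^bsub>H\<^esub>}"
    by (rule finite_subset[of _ "{b}"]) (auto simp: single_lamp_def)
  then show ?thesis using h0 by (auto simp: carrier_lamp single_lamp_def)
qed

text \<open>The value is -1 for \<open>b\<close> in \<open>B\<close> and 1 for \<open>b\<close> in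
  \<open>A\<close> alone; otherwise it is 0, since a lamp that must be off is lit.\<close>

lemma config_single_lamp:
  assumes "finite B" "B \<subseteq> carrier G" "b \<in> carrier G"
  shows "config A B (single_lamp b) \<noteq> 0 \<longleftrightarrow> b \<in> A \<union> B"
  using assms h0 by (auto simp: config_def single_lamp_def lamp_sign_def)

text \<open>Separation gives injectivity along with independence, so the set of functions is as
  infinite as the index set.\<close>

lemma eigenspace_of_separated_family:
  assumes "infinite I"
    and "\<And>b. b \<in> I \<Longrightarrow> F b \<in> eigenspace W \<alpha> l" "\<And>b. b \<in> I \<Longrightarrow> finite {z. F b z \<noteq> 0}"
    and "\<And>b. b \<in> I \<Longrightarrow> F b (t b) \<noteq> 0"
    and "\<And>b c. b \<in> I \<Longrightarrow> c \<in> I \<Longrightarrow> b \<noteq> c \<Longrightarrow> F c (t b) = 0"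
  shows "\<exists>B. infinite B \<and> B \<subseteq> eigenspace W \<alpha> l \<and> (\<forall>F\<in>B. finite {z. F z \<noteq> 0}) \<and>
    cfun.independent B"
proof -
  have "inj_on F I" and "cfun.independent (F ` I)"
    using independent_if_separated[of I F t] assms(4,5) by blast+
  then show ?thesis
    using assms(1-3) by (intro exI[of _ "F ` I"]) (auto dest: finite_imageD)
qed

section \<open>Eigenfunctions for each element of \<open>Lambda_set\<close>\<close>

lemma Lambda_set_cases:
  assumes "l \<in> Lambda_set G \<mu>"
  obtains "l = 0" | A where "A \<subseteq> carrier G" "finite A" "l \<in> spectrum (P_matrix G \<mu> A)"
  using assms by (auto simp: Lambda_set_def clusters_def)

definition outer_boundary :: "'g pmf \<Rightarrow> 'g set \<Rightarrow> 'g set"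
  where "outer_boundary \<mu> A = (\<lambda>(x, s). x \<otimes>\<^bsub>G\<^esub> s) ` (A \<times> set_pmf \<mu>) - A"

lemma outer_boundary:
  assumes "set_pmf \<mu> \<subseteq> carrier G" "finite (set_pmf \<mu>)" "A \<subseteq> carrier G" "finite A"
  shows "finite (outer_boundary \<mu> A)" "outer_boundary \<mu> A \<subseteq> carrier G"
    "x \<in> A \<Longrightarrow> s \<in> set_pmf \<mu> \<Longrightarrow> x \<otimes>\<^bsub>G\<^esub> s \<in> A \<union> outer_boundary \<mu> A"
    "A \<inter> outer_boundary \<mu> A = {}"
  using assms by (auto simp: outer_boundary_def)

text \<open>The infinite family is claimed for infinite \<open>G\<close> only: for finite
  \<open>G\<close> the wreath product is finite and its \<open>ell2\<close> has finite
  dimension.\<close>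

lemma Lambda_set_eigenfunctions:
  assumes \<mu>: "set_pmf \<mu> \<subseteq> carrier G" "finite (set_pmf \<mu>)" and sym: "symmetric_pmf G \<mu>"
    and l: "l \<in> Lambda_set G \<mu>"
  shows "l \<in> point_spectrum W (mu_tilde H G \<mu>)" (is ?spec)
    and "infinite (carrier G) \<Longrightarrow> \<exists>B. infinite B \<and> B \<subseteq> eigenspace W (mu_tilde H G \<mu>) l \<and>
      (\<forall>F\<in>B. finite {z. F z \<noteq> 0}) \<and> cfun.independent B" (is "_ \<Longrightarrow> ?many")
proof -
  from l have "?spec \<and> (infinite (carrier G) \<longrightarrow> ?many)"
  proof (cases rule: Lambda_set_cases)
    case 1
    define F where "F b = tensor (\<lambda>x. if x = b then 1 else 0) (config {} {b})" for b
    have eig: "F b \<in> eigenspace W (mu_tilde H G \<mu>) l" if "b \<in> carrier G" for b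
      unfolding F_def 1 using that by (intro tensor_config_kernel \<mu>) auto
    have fin: "finite {z. F b z \<noteq> 0}" if "b \<in> carrier G" for b
      unfolding F_def using that by (intro finite_support_tensor_config) auto
    have diag: "F b (single_lamp b, b) \<noteq> 0" if "b \<in> carrier G" for b
      using that config_single_lamp[of "{b}" b "{}"]
      by (simp add: F_def tensor_def single_lamp_carrier)
    \<comment> \<open>For the eigenvalue 0 the position alone separates the functions:
      \<open>F c\<close> is supported over the position \<open>c\<close>.\<close>
    have off: "F c (single_lamp b, b) = 0" if "b \<noteq> c" for b c
      using that by (simp add: F_def tensor_def)
    have ?spec
      by (rule eigenvector_in_point_spectrum[OF eig[of "\<one>\<^bsub>G\<^esub>"]]) (use diag[of "\<one>\<^bsub>G\<^esub>"] in auto)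
    moreover have ?many if "infinite (carrier G)"
      by (rule eigenspace_of_separated_family[OF that, of F _ _ "\<lambda>b. (single_lamp b, b)"])
        (use eig fin diag off in auto)
    ultimately show ?thesis by blast
  next
    case (2 A)
    obtain f :: "'g \<Rightarrow> complex" where f: "\<And>x. x \<notin> A \<Longrightarrow> f x = 0" "\<exists>x\<in>A. f x \<noteq> 0"
      "\<And>y. y \<in> A \<Longrightarrow> (\<Sum>x\<in>A. f x * of_real (pmf \<mu> (inv\<^bsub>G\<^esub> x \<otimes>\<^bsub>G\<^esub> y))) = l * f y"
      using P_matrix_eigenfunction[OF G.is_group sym 2(2,1,3)] by blast
    \<comment> \<open>All test points share the position \<open>a\<close>; as \<open>f a\<close> is
      nonzero, the lamp factor alone decides whether a value vanishes.\<close>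
    obtain a where a: "a \<in> A" "f a \<noteq> 0" using f(2) by blast
    let ?D = "outer_boundary \<mu> A"
    note D = outer_boundary[OF \<mu> 2(1,2)]
    have eig: "tensor f (config A B) \<in> eigenspace W (mu_tilde H G \<mu>) l"
      if "finite B" "B \<subseteq> carrier G" "?D \<subseteq> B" "A \<inter> B = {}" for B
    proof (rule tensor_config_eigenfunction[OF \<mu> 2(2) that(1) _ that(4) _ f(1,3)])
      show "A \<union> B \<subseteq> carrier G" using 2(1) that(2) by blast
      show "x \<otimes>\<^bsub>G\<^esub> s \<in> A \<union> B" if "x \<in> A" "s \<in> set_pmf \<mu>" for x s
        using D(3)[OF that] \<open>?D \<subseteq> B\<close> by blast
    qed
    have nonzero: "tensor f (config A B) (single_lamp b, a) \<noteq> 0 \<longleftrightarrow> b \<in> A \<union> B"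
      if "finite B" "B \<subseteq> carrier G" "b \<in> carrier G" for b B
      using config_single_lamp[OF that] a 2(1) by (auto simp: tensor_def single_lamp_carrier)
    \<comment> \<open>Here \<open>B\<close> is just the boundary, and the test lamp is lit at
      \<open>a\<close>, a point of \<open>A\<close> where lamps are free, so the value is
      nonzero.\<close>
    have ?spec
      by (rule eigenvector_in_point_spectrum[OF eig[of ?D]]) (use D(1,2,4) nonzero[of ?D a] a 2(1) in \<open>auto simp del: Un_iff\<close>)
    moreover have ?many if inf: "infinite (carrier G)"
    proof (rule eigenspace_of_separated_family[where
          I = "carrier G - (A \<union> ?D)" and F = "\<lambda>b. tensor f (config A (insert b ?D))"
          and t = "\<lambda>b. (single_lamp b, a)"])
      show "infinite (carrier G - (A \<union> ?D))"
        using inf D(1) 2(2) by (simp add: Diff_infinite_finite)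
    next
      fix b assume b: "b \<in> carrier G - (A \<union> ?D)"
      show "tensor f (config A (insert b ?D)) \<in> eigenspace W (mu_tilde H G \<mu>) l"
        using b D(1,2,4) by (intro eig) auto
      show "finite {z. tensor f (config A (insert b ?D)) z \<noteq> 0}"
        using b D(1,2) 2(1,2) f(1) by (intro finite_support_tensor_config) auto
      show "tensor f (config A (insert b ?D)) (single_lamp b, a) \<noteq> 0"
        using b D(1,2) nonzero[of "insert b ?D" b] by auto
    next
      fix b c assume bc: "b \<in> carrier G - (A \<union> ?D)" "c \<in> carrier G - (A \<union> ?D)" "b \<noteq> c"
      \<comment> \<open>The lamp lit at \<open>b\<close> lies outside \<open>A\<close>, the boundary
        and \<open>{c}\<close>, where \<open>config\<close> demands that it be off.\<close>
      show "tensor f (config A (insert c ?D)) (single_lamp b, a) = 0"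
        using bc D(1,2) nonzero[of "insert c ?D" b] by auto
    qed
    ultimately show ?thesis by blast
  qed
  then show ?spec and "infinite (carrier G) \<Longrightarrow> ?many" by auto
qed

end

theorem mainTheorem2:
  fixes G :: "('g, 'm) monoid_scheme" and H :: "('h, 'n) monoid_scheme" and \<mu> :: "'g pmf"
  assumes "Group.group G"
    and "Group.group H" and "finite (carrier H)" and "card (carrier H) \<ge> 2"
    and "set_pmf \<mu> \<subseteq> carrier G" and "finite (set_pmf \<mu>)"
    and "generate G (set_pmf \<mu>) = carrier G"
    and "symmetric_pmf G \<mu>"
  shows "Lambda_set G \<mu> \<subseteq> point_spectrum (wreath H G) (mu_tilde H G \<mu>) \<and>
    (infinite (carrier G) \<longrightarrow>
      (\<forall>l\<in>Lambda_set G \<mu>. \<exists>B. infinite B \<and>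
        B \<subseteq> eigenspace (wreath H G) (mu_tilde H G \<mu>) l \<and>
        (\<forall>F\<in>B. finite {x. F x \<noteq> 0}) \<and>
        cfun.independent B))"
proof -
  interpret H: Group.group H by fact
  obtain h0 where h0: "h0 \<in> carrier H" "h0 \<noteq> \<one>\<^bsub>H\<^esub>"
  proof (rule ccontr)
    assume "\<not> thesis"
    then have "carrier H \<subseteq> {\<one>\<^bsub>H\<^esub>}" using that by blast
    then have "card (carrier H) \<le> 1" using card_mono[of "{\<one>\<^bsub>H\<^esub>}"] by simp
    then show False using assms(4) by simp
  qed
  interpret lamplighter G H h0
    using assms(1-3) h0 by (simp add: lamplighter_def lamplighter_axioms_def)
  show ?thesis
    using Lambda_set_eigenfunctions[OF assms(5,6,8)] by blast
qed

end
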